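(* For all nonnegative integers $n,m,k$, $$\det\left(\binom{i+j+k+m}{i-j+m}\right)_{i,j=0}^{n-1}=\det\left(\binom{2n+m+k-i-j}{j-i+m}\right)_{i,j=1}^{n}=\det\left(C_{n-i+j}^{(2i+k+1)}\right)_{i,j=0}^{m-1}.$$
   Context: Binomial coefficients $\binom{a}{b}$ with $a\ge0$ vanish if $b<0$ or $b>a$. For a positive integer $r$ and integer $\ell$, $C_\ell^{(r)}=\frac{r}{2\ell+r}\binom{2\ell+r}{\ell}$ if $\ell\ge0$ and $C_\ell^{(r)}=0$ if $\ell<0$; equivalently $\sum_{\ell\ge0}C_\ell^{(r)}z^\ell=c(z)^r$ where $c(z)=\sum_{\ell\ge0}\frac{1}{\ell+1}\binom{2\ell}{\ell}z^\ell$ is the Catalan generating function. Determinants of $0\times0$ matrices equal $1$. *)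

theory Defs
  imports "Jordan_Normal_Form.Determinant"
begin

(* Only a >= 0 is used below.  The library's gchoose vanishes for 0 <= a < b by itself,
   see binom_nonneg and binom_eq_0. *)
definition binom :: "int \<Rightarrow> int \<Rightarrow> rat" where
  "binom a b = (if b < 0 then 0 else of_int a gchoose nat b)"

lemma binom_nonneg:
  assumes "0 \<le> a" "0 \<le> b"
  shows "binom a b = of_nat (nat a choose nat b)"
  using assms by (simp add: binom_def binomial_gbinomial)

lemma binom_eq_0:
  assumes "0 \<le> a" "b < 0 \<or> a < b"
  shows "binom a b = 0"
proof (cases "b < 0")
  case True
  then show ?thesis by (simp add: binom_def)
next
  case False
  with assms show ?thesis by (simp add: binom_nonneg binomial_eq_0)
qed

(* Coefficient of z^l in the r-th power of the Catalan generating function, for r > 0. *)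
definition catalan_conv :: "nat \<Rightarrow> int \<Rightarrow> rat" where
  "catalan_conv r l =
     (if l < 0 then 0
      else of_nat r / of_int (2 * l + int r) * binom (2 * l + int r) l)"

end

theory Submission imports Defs
begin

text \<open>The first two matrices differ by reversing the order of rows and columns. The first one is the
  lower left \<open>n \<times> n\<close> block of the unitriangular matrix of size \<open>n + m\<close> with entries
  \<open>binom (i + j + k) (i - j)\<close>. This is a Riordan array, and its inverse has the entries
  \<open>(-1) ^ (i + j) * catalan_conv (2 * j + k + 1) (i - j)\<close>. Jacobi's complementary minor formula
  turns the block into the lower left \<open>m \<times> m\<close> block of the inverse, and the sign \<open>(-1) ^ (n * m)\<close>
  of that formula cancels against the alternating signs of the inverse.\<close>

section \<open>Determinants under permutations, complementary minors and sign patterns\<close>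

lemma det_permute_rows_cols:
  fixes A :: "'a :: comm_ring_1 mat"
  assumes A: "A \<in> carrier_mat n n" and p: "p permutes {0..<n}"
  shows "det (mat n n (\<lambda>(i, j). A $$ (p i, p j))) = det A"
proof -
  define B where "B = mat n n (\<lambda>(i, j). A $$ (p i, j))"
  have B: "B \<in> carrier_mat n n"
    by (simp add: B_def)
  have lt: "p i < n" if "i < n" for i
    using permutes_in_image[OF p, of i] that by auto
  have "det (mat n n (\<lambda>(i, j). A $$ (p i, p j)))
      = det (mat n n (\<lambda>(i, j). A $$ (p i, p j)))\<^sup>T"
    by (rule det_transpose[symmetric]) auto
  also have "(mat n n (\<lambda>(i, j). A $$ (p i, p j)))\<^sup>T = mat n n (\<lambda>(i, j). B\<^sup>T $$ (p i, j))"
    by (rule eq_matI) (auto simp: B_def lt)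
  \<comment> \<open>The columns, as rows of the transpose, and the rows contribute one factor
    \<open>signof p\<close> each; these multiply to 1.\<close>
  also have "det \<dots> = signof p * (signof p * det A)"
    using det_permute_rows[OF _ p, of "B\<^sup>T"] det_permute_rows[OF A p] B
    by (simp add: det_transpose[OF B] flip: B_def)
  also have "\<dots> = det A"
    by (auto simp: sign_def)
  finally show ?thesis .
qed

lemma det_reverse_rows_cols:
  fixes f :: "nat \<Rightarrow> nat \<Rightarrow> 'a :: comm_ring_1"
  shows "det (mat n n (\<lambda>(i, j). f (n - 1 - i) (n - 1 - j))) = det (mat n n (\<lambda>(i, j). f i j))"
proof -
  define p where "p i = (if i < n then n - 1 - i else i)" for i
  have p: "p permutes {0..<n}"
    by (rule bij_imp_permutes)
       (auto simp: p_def intro!: bij_betwI[where g = p])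
  have "mat n n (\<lambda>(i, j). f (n - 1 - i) (n - 1 - j))
      = mat n n (\<lambda>(i, j). mat n n (\<lambda>(i, j). f i j) $$ (p i, p j))"
    by (rule eq_matI) (auto simp: p_def)
  then show ?thesis
    using det_permute_rows_cols[OF _ p, of "mat n n (\<lambda>(i, j). f i j)"] by simp
qed

text \<open>Jacobi's complementary minor formula for the lower left blocks of a matrix and its inverse:
  replacing the last \<open>m\<close> columns of the identity by the first \<open>m\<close> columns of \<open>B\<close> and multiplying
  by \<open>A\<close> leaves the first \<open>n\<close> columns of \<open>A\<close> followed by the first \<open>m\<close> columns of the identity.\<close>

lemma det_lower_left_block_inverse:
  fixes A B :: "'a :: idom mat"
  assumes A: "A \<in> carrier_mat (n + m) (n + m)" and B: "B \<in> carrier_mat (n + m) (n + m)"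
    and AB: "A * B = 1\<^sub>m (n + m)"
  shows "det A * det (mat m m (\<lambda>(i, j). B $$ (n + i, j)))
       = (-1) ^ (n * m) * det (mat n n (\<lambda>(i, j). A $$ (m + i, j)))"
proof -
  define X where "X = mat (n + m) (n + m)
    (\<lambda>(i, j). if j < n then (if i = j then 1 else 0) else B $$ (i, j - n))"
  have X: "X \<in> carrier_mat (n + m) (n + m)"
    by (simp add: X_def)
  define Y where "Y = A * X"
  have Y: "Y \<in> carrier_mat (n + m) (n + m)"
    using A X by (simp add: Y_def)
  have X_block: "X = four_block_mat (1\<^sub>m n) (mat n m (\<lambda>(i, j). B $$ (i, j))) (0\<^sub>m m n)
      (mat m m (\<lambda>(i, j). B $$ (n + i, j)))"
    by (rule eq_matI) (auto simp: X_def)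
  have det_X: "det X = det (mat m m (\<lambda>(i, j). B $$ (n + i, j)))"
    unfolding X_block by (subst det_four_block_mat_lower_left_zero) auto
  have Y_left: "Y $$ (i, j) = A $$ (i, j)" if "i < n + m" "j < n" for i j
  proof -
    have "Y $$ (i, j) = (\<Sum>l = 0..<n + m. A $$ (i, l) * X $$ (l, j))"
      using that A X by (simp add: Y_def scalar_prod_def)
    also have "\<dots> = (\<Sum>l = 0..<n + m. if l = j then A $$ (i, l) else 0)"
      using that by (intro sum.cong) (auto simp: X_def)
    finally show ?thesis
      using that by simp
  qed
  have Y_right: "Y $$ (i, n + j) = (if i = j then 1 else 0)" if "i < n + m" "j < m" for i j
  proof -
    have "Y $$ (i, n + j) = (\<Sum>l = 0..<n + m. A $$ (i, l) * X $$ (l, n + j))"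
      using that A X by (simp add: Y_def scalar_prod_def)
    also have "\<dots> = (\<Sum>l = 0..<n + m. A $$ (i, l) * B $$ (l, j))"
      using that by (intro sum.cong) (auto simp: X_def)
    also have "\<dots> = (A * B) $$ (i, j)"
      using that A B by (simp add: scalar_prod_def)
    finally show ?thesis
      using that by (simp add: AB)
  qed
  \<comment> \<open>Moving the first \<open>m\<close> rows of \<open>Y\<close> to the bottom costs
    the sign \<open>(-1) ^ (n * m)\<close> and puts the identity block on the diagonal.\<close>
  have swapped: "mat (n + m) (n + m) (\<lambda>(i, j). Y $$ ((if i < n then i + m else i - n), j))
      = four_block_mat (mat n n (\<lambda>(i, j). A $$ (m + i, j))) (0\<^sub>m n m)
          (mat m n (\<lambda>(i, j). A $$ (i, j))) (1\<^sub>m m)" (is "?L = ?R")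
  proof (rule eq_matI)
    fix i j assume "i < dim_row ?R" "j < dim_col ?R"
    then have ij: "i < n + m" "j < n + m" by auto
    show "?L $$ (i, j) = ?R $$ (i, j)"
    proof (cases "j < n")
      case True
      then show ?thesis using ij by (auto simp: Y_left add.commute)
    next
      case False
      then obtain j' where "j = n + j'" "j' < m"
        using ij by (metis add_less_cancel_left le_Suc_ex not_less)
      then show ?thesis using ij by (auto simp: Y_right)
    qed
  qed auto
  have "det A * det (mat m m (\<lambda>(i, j). B $$ (n + i, j))) = det Y"
    unfolding Y_def det_X[symmetric] by (rule det_mult[OF A X, symmetric])
  also have "\<dots> = (-1) ^ (n * m) * det (mat n n (\<lambda>(i, j). A $$ (m + i, j)))"
    unfolding det_swap_rows[OF Y] swapped
    by (subst det_four_block_mat_upper_right_zero) auto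
  finally show ?thesis .
qed

text \<open>Every Leibniz term carries the same sign: a permutation preserves the sum of the
  indices, so the exponents add up to \<open>n * m\<close> plus an even number.\<close>

lemma det_alternating_signs:
  fixes f :: "nat \<Rightarrow> nat \<Rightarrow> 'a :: comm_ring_1"
  shows "det (mat m m (\<lambda>(i, j). (-1) ^ (n + i + j) * f i j))
       = (-1) ^ (n * m) * det (mat m m (\<lambda>(i, j). f i j))"
proof -
  have "(\<Prod>i = 0..<m. (-1) ^ (n + i + p i)) = (-1 :: 'a) ^ (n * m)" if p: "p permutes {0..<m}" for p
  proof -
    have "(\<Sum>i = 0..<m. p i) = (\<Sum>i = 0..<m. i)"
      using sum.permute[OF p, of "\<lambda>i. i"] by (simp add: o_def)
    then have "(\<Sum>i = 0..<m. n + i + p i) = n * m + 2 * (\<Sum>i = 0..<m. i)"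
      by (simp add: sum.distrib)
    then show ?thesis
      unfolding power_sum[symmetric] by (simp add: power_add power_mult)
  qed
  then show ?thesis
    by (auto simp: det_def'[of _ m] prod.distrib sum_distrib_left permutes_in_image algebra_simps
        intro!: sum.cong)
qed

section \<open>Coefficients of powers of the Catalan series\<close>

text \<open>\<open>ballot r l\<close> is the coefficient of \<open>z ^ l\<close> in the \<open>r\<close>-th power of the Catalan series; the
  reflection principle form also covers \<open>r = 0\<close>, where \<^const>\<open>catalan_conv\<close> has the junk value
  0 at \<open>l = 0\<close>.\<close>

fun ballot :: "nat \<Rightarrow> nat \<Rightarrow> rat" where
  "ballot r 0 = 1"
| "ballot r (Suc l) = of_nat ((2 * l + r + 1) choose Suc l) - of_nat ((2 * l + r + 1) choose l)"

lemma ballot_0: "ballot 0 l = (if l = 0 then 1 else 0)"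
proof (cases l)
  case (Suc l')
  then show ?thesis
    using binomial_symmetric[of l' "2 * l' + 1"] by simp
qed simp

text \<open>Coefficient form of \<open>c = 1 + z * c^2\<close> for the Catalan series
  \<open>c\<close>, multiplied by \<open>c^r\<close>.\<close>

lemma ballot_Suc: "ballot (Suc r) (Suc l) = ballot r (Suc l) + ballot (Suc (Suc r)) l"
  by (cases l) (auto simp: algebra_simps)

text \<open>Absorption identities bring both sides to \<open>r / (l' + 1)\<close> times
  \<open>M choose l'\<close>, where \<open>l = l' + 1\<close>.\<close>

lemma catalan_conv_eq_ballot:
  assumes "r > 0"
  shows "catalan_conv r (int l) = ballot r l"
proof (cases l)
  case 0
  with assms show ?thesis by (simp add: catalan_conv_def binom_def)
next
  case (Suc l')
  define M where "M = 2 * l' + r + 1"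
  have a: "of_nat (Suc l') * rat_of_nat (Suc M choose Suc l') = of_nat (Suc M) * of_nat (M choose l')"
    by (metis Suc_times_binomial_eq mult.commute of_nat_mult)
  have "Suc l' * (M choose Suc l') = (M - l') * (M choose l')"
    by (metis binomial_absorb_comp binomial_absorption mult.commute)
  then have b: "of_nat (Suc l') * rat_of_nat (M choose Suc l')
      = (of_nat M - of_nat l') * of_nat (M choose l')"
    by (metis M_def add.commute le_add1 mult_2 of_nat_diff of_nat_mult trans_le_add2)
  have "catalan_conv r (int l) = of_nat r / of_nat (Suc M) * of_nat (Suc M choose Suc l')"
    using Suc by (simp add: catalan_conv_def binom_nonneg M_def nat_add_distrib nat_mult_distrib)
  also have "\<dots> = of_nat r * of_nat (M choose l') / of_nat (Suc l')"
    using a by (simp add: field_simps del: of_nat_Suc binomial_Suc_Suc)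
  also have "\<dots> = of_nat (M choose Suc l') - of_nat (M choose l')"
    using b by (simp add: field_simps M_def)
  also have "\<dots> = ballot r l"
    using Suc by (simp add: M_def)
  finally show ?thesis .
qed

text \<open>With \<open>c\<close> the Catalan series, both sides are the coefficient of \<open>z ^ s\<close> in
  \<open>(1 - z) ^ - (q + 1) * c (- z / (1 - z)\<^sup>2) ^ r = (1 - z) ^ (r - q - 1)\<close>.\<close>

lemma sum_ballot_binomial:
  "(\<Sum>p\<le>s. (-1) ^ p * of_nat ((s + p + q) choose (s - p)) * ballot r p)
     = (of_nat s + of_nat q - of_nat r) gchoose s"
proof (induction s arbitrary: q r)
  case 0
  then show ?case by simp
next
  case (Suc s)
  note IH = Suc.IH
  show ?case
  \<comment> \<open>\<open>ballot_Suc\<close> splits the sum for \<open>Suc r\<close> into the one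
    for \<open>r\<close> with the same \<open>s\<close>, and minus one with \<open>s\<close> lowered
    by 1, \<open>q\<close> raised by 2 and \<open>Suc r\<close> raised by 1. The latter is why the
    outer induction generalizes \<open>q\<close> and \<open>r\<close>. Pascal's rule combines the
    two values.\<close>
  proof (induction r)
    case 0
    have "(\<Sum>p\<le>Suc s. (-1) ^ p * of_nat ((Suc s + p + q) choose (Suc s - p)) * ballot 0 p)
        = (\<Sum>p\<le>Suc s. if p = 0 then rat_of_nat ((Suc s + q) choose Suc s) else 0)"
      by (intro sum.cong) (auto simp: ballot_0)
    also have "\<dots> = (of_nat (Suc s) + of_nat q - of_nat 0) gchoose Suc s"
      by (simp add: binomial_gbinomial add.assoc del: binomial_Suc_Suc)
    finally show ?case .
  next
    case (Suc r)
    let ?b = "\<lambda>p. (-1) ^ p * rat_of_nat ((Suc s + p + q) choose (Suc s - p))"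
    have "(\<Sum>p\<le>Suc s. ?b p * ballot (Suc r) p)
        = ?b 0 + (\<Sum>p\<le>s. ?b (Suc p) * ballot (Suc r) (Suc p))"
      by (subst sum.atMost_Suc_shift) simp
    also have "\<dots> = (?b 0 + (\<Sum>p\<le>s. ?b (Suc p) * ballot r (Suc p)))
        + (\<Sum>p\<le>s. ?b (Suc p) * ballot (Suc (Suc r)) p)"
      unfolding ballot_Suc distrib_left sum.distrib by (simp only: add.assoc)
    also have "?b 0 + (\<Sum>p\<le>s. ?b (Suc p) * ballot r (Suc p)) = (\<Sum>p\<le>Suc s. ?b p * ballot r p)"
      by (subst sum.atMost_Suc_shift) simp
    also have "\<dots> = (of_nat (Suc s) + of_nat q - of_nat r) gchoose Suc s"
      by (rule Suc.IH)
    also have "(\<Sum>p\<le>s. ?b (Suc p) * ballot (Suc (Suc r)) p)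
        = - (\<Sum>p\<le>s. (-1) ^ p * of_nat ((s + p + (q + 2)) choose (s - p)) * ballot (Suc (Suc r)) p)"
      unfolding sum_negf[symmetric]
      by (intro sum.cong) (simp_all add: algebra_simps del: binomial_Suc_Suc)
    also have "\<dots> = - ((of_nat s + of_nat (q + 2) - of_nat (Suc (Suc r))) gchoose s)"
      unfolding IH ..
    also have "(of_nat (Suc s) + of_nat q - of_nat r :: rat) gchoose Suc s =
        ((of_nat s + of_nat q - of_nat r) gchoose s) + ((of_nat s + of_nat q - of_nat r) gchoose Suc s)"
      using gbinomial_Suc_Suc[of "of_nat s + of_nat q - of_nat r :: rat" s]
      by (simp add: algebra_simps)
    finally show ?case
      by (simp add: algebra_simps)
  qed
qed

section \<open>Two mutually inverse triangular matrices\<close>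

definition binom_triangle :: "nat \<Rightarrow> nat \<Rightarrow> rat mat" where
  "binom_triangle k N = mat N N (\<lambda>(i, j). if j \<le> i then of_nat ((i + j + k) choose (i - j)) else 0)"

text \<open>In both triangles the zeros above the diagonal are explicit, because truncated
  subtraction would make \<open>i - j\<close> zero there and the entries nonzero.\<close>

definition ballot_triangle :: "nat \<Rightarrow> nat \<Rightarrow> rat mat" where
  "ballot_triangle k N =
     mat N N (\<lambda>(i, j). if j \<le> i then (-1) ^ (i + j) * ballot (2 * j + k + 1) (i - j) else 0)"

lemma binom_triangle_carrier [simp]: "binom_triangle k N \<in> carrier_mat N N"
  by (simp add: binom_triangle_def)

lemma ballot_triangle_carrier [simp]: "ballot_triangle k N \<in> carrier_mat N N"
  by (simp add: ballot_triangle_def)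

lemma det_binom_triangle: "det (binom_triangle k N) = 1"
  by (subst det_lower_triangular[of N])
     (auto simp: binom_triangle_def prod_list_diag_prod)

lemma binom_triangle_mult_ballot_triangle: "binom_triangle k N * ballot_triangle k N = 1\<^sub>m N"
proof (rule eq_matI)
  fix i j assume "i < dim_row (1\<^sub>m N :: rat mat)" "j < dim_col (1\<^sub>m N :: rat mat)"
  then have ij: "i < N" "j < N" by auto
  let ?f = "\<lambda>l. binom_triangle k N $$ (i, l) * ballot_triangle k N $$ (l, j)"
  have prod: "(binom_triangle k N * ballot_triangle k N) $$ (i, j) = (\<Sum>l = 0..<N. ?f l)"
    using ij binom_triangle_carrier[of k N] ballot_triangle_carrier[of k N]
    by (simp add: scalar_prod_def binom_triangle_def ballot_triangle_def)
  show "(binom_triangle k N * ballot_triangle k N) $$ (i, j) = 1\<^sub>m N $$ (i, j)"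
  proof (cases "j \<le> i")
    case False
    then show ?thesis
      unfolding prod using ij
      by (auto simp: binom_triangle_def ballot_triangle_def intro!: sum.neutral)
  next
    case True
    define s where "s = i - j"
    have i: "i = j + s"
      using True by (simp add: s_def)
    have "(\<Sum>l = 0..<N. ?f l) = (\<Sum>l = j..j + s. ?f l)"
      using ij
      by (intro sum.mono_neutral_right) (auto simp: i binom_triangle_def ballot_triangle_def)
    also have "\<dots> = (\<Sum>p\<le>s. ?f (j + p))"
      using sum.shift_bounds_cl_nat_ivl[of ?f 0 j s] by (simp add: add.commute atLeast0AtMost)
    also have "\<dots> = (\<Sum>p\<le>s. (-1) ^ p * of_nat ((s + p + (2 * j + k)) choose (s - p))
        * ballot (2 * j + k + 1) p)"
    proof (intro sum.cong refl)
      fix p assume "p \<in> {..s}"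
      moreover have "(-1) ^ (j + p + j) = (-1 :: rat) ^ p"
        by (simp add: power_add mult_ac flip: power_mult_distrib)
      ultimately show "?f (j + p) = (-1) ^ p * of_nat ((s + p + (2 * j + k)) choose (s - p))
        * ballot (2 * j + k + 1) p"
        using ij by (simp add: i binom_triangle_def ballot_triangle_def mult_2 add_ac)
    qed
    \<comment> \<open>Here \<open>q = 2 * j + k\<close> and \<open>r = q + 1\<close>, so the upper
      index is \<open>s - 1\<close>: for positive \<open>s\<close> a natural number below
      \<open>s\<close>, which makes the coefficient vanish.\<close>
    also have "\<dots> = (of_nat s - 1) gchoose s"
      unfolding sum_ballot_binomial by simp
    also have "\<dots> = (if s = 0 then 1 else 0)"
    proof (cases s)
      case (Suc t)
      then show ?thesis
        using binomial_gbinomial[of t "Suc t", where ?'a = rat] by (simp add: binomial_eq_0)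
    qed simp
    finally show ?thesis
      unfolding prod using ij by (simp add: i)
  qed
qed (auto simp: binom_triangle_def ballot_triangle_def)

lemma det_binom_eq_det_catalan_conv:
  "det (mat n n (\<lambda>(i, j). binom (int i + int j + int k + int m) (int i - int j + int m)))
     = det (mat m m (\<lambda>(i, j). catalan_conv (2 * i + k + 1) (int n - int i + int j)))"
    (is "det ?A = det ?C")
proof -
  \<comment> \<open>\<open>?f\<close> is the transpose of the target: in the inverse triangle the
    power of the Catalan series depends on the column.\<close>
  let ?f = "\<lambda>i j. catalan_conv (2 * j + k + 1) (int n - int j + int i)"
  have A: "mat n n (\<lambda>(i, j). binom_triangle k (n + m) $$ (m + i, j)) = ?A"
  proof (rule eq_matI)
    fix i j assume "i < dim_row ?A" "j < dim_col ?A"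
    then have ij: "i < n" "j < n" by auto
    show "mat n n (\<lambda>(i, j). binom_triangle k (n + m) $$ (m + i, j)) $$ (i, j) = ?A $$ (i, j)"
    proof (cases "j \<le> m + i")
      case True
      then have "nat (int i + int j + int k + int m) = m + i + j + k"
        "nat (int i - int j + int m) = m + i - j"
        by linarith+
      with True ij show ?thesis by (simp add: binom_triangle_def binom_nonneg)
    next
      case False
      with ij show ?thesis by (simp add: binom_triangle_def binom_def)
    qed
  qed auto
  have B: "mat m m (\<lambda>(i, j). ballot_triangle k (n + m) $$ (n + i, j))
      = mat m m (\<lambda>(i, j). (-1) ^ (n + i + j) * ?f i j)" (is "?L = ?R")
  proof (rule eq_matI)
    fix i j assume "i < dim_row ?R" "j < dim_col ?R"
    then have ij: "i < m" "j < m" by auto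
    show "?L $$ (i, j) = ?R $$ (i, j)"
    proof (cases "j \<le> n + i")
      case True
      then have "int n - int j + int i = int (n + i - j)"
        by linarith
      with True ij show ?thesis by (simp add: ballot_triangle_def flip: catalan_conv_eq_ballot)
    next
      case False
      with ij show ?thesis by (simp add: ballot_triangle_def catalan_conv_def)
    qed
  qed auto
  have "(-1) ^ (n * m) * det ?A = (-1) ^ (n * m) * det (mat m m (\<lambda>(i, j). ?f i j))"
    using det_lower_left_block_inverse[OF binom_triangle_carrier ballot_triangle_carrier
        binom_triangle_mult_ballot_triangle, of k n m]
    unfolding A B det_alternating_signs det_binom_triangle by simp
  then have "det ?A = det (mat m m (\<lambda>(i, j). ?f i j))"
    by simp
  also have "mat m m (\<lambda>(i, j). ?f i j) = ?C\<^sup>T"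
    by (rule eq_matI) auto
  also have "det \<dots> = det ?C"
    by (rule det_transpose) auto
  finally show ?thesis .
qed

theorem theorem6:
  fixes n m k :: nat
  shows "det (mat n n (\<lambda>(i, j). binom (int i + int j + int k + int m) (int i - int j + int m)))
       = det (mat n n (\<lambda>(i', j'). let i = int i' + 1; j = int j' + 1 in
                binom (2 * int n + int m + int k - i - j) (j - i + int m)))
     \<and> det (mat n n (\<lambda>(i', j'). let i = int i' + 1; j = int j' + 1 in
                binom (2 * int n + int m + int k - i - j) (j - i + int m)))
       = det (mat m m (\<lambda>(i, j). catalan_conv (2 * i + k + 1) (int n - int i + int j)))"
proof -
  let ?f = "\<lambda>i j. binom (int i + int j + int k + int m) (int i - int j + int m)"
  \<comment> \<open>With 1-based \<open>i\<close> and \<open>j\<close>, substituting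
    \<open>n - i\<close> and \<open>n - j\<close> for the indices of \<open>?f\<close> gives these
    arguments; in 0-based indices this is \<open>n - 1 - i'\<close> and
    \<open>n - 1 - j'\<close>.\<close>
  have "mat n n (\<lambda>(i', j'). let i = int i' + 1; j = int j' + 1 in
          binom (2 * int n + int m + int k - i - j) (j - i + int m))
      = mat n n (\<lambda>(i, j). ?f (n - 1 - i) (n - 1 - j))"
    by (rule eq_matI) (auto simp: Let_def of_nat_diff algebra_simps intro!: arg_cong2[of _ _ _ _ binom])
  then show ?thesis
    using det_reverse_rows_cols[of n ?f] det_binom_eq_det_catalan_conv[of n k m] by simp
qed

end
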